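(* Let $K$ be a field of characteristic zero, $\mathfrak u$ a finite-dimensional nilpotent Lie algebra over $K$, $U=\exp(\mathfrak u)$, $\mathcal A$ a finitely generated commutative associative $K$-algebra without zero divisors, and $D:x\mapsto D_x$ a Lie algebra homomorphism from $\mathfrak u$ to the derivations of $\mathcal A$ such that every $D_x$ is locally nilpotent. Let $S_1,\dots,S_m$, the localization $\mathcal A_*$ of $\mathcal A$, and $P=S_m\circ\cdots\circ S_2\circ S_1$ be constructed as described in the context (for any choices made in the construction). Then $P$ is a homomorphism of the algebra $\mathcal A$ into $\mathcal A_*^{\mathfrak u}$ which is identical on $\mathcal A^{\mathfrak u}$. That is, $P$ is a $U$-projector.
   Context: For a subalgebra $\mathfrak v\subseteq\mathfrak u$ and a $\mathfrak u$-stable algebra $\mathcal B$ in $\mathcal F=\mathrm{Frac}(\mathcal A)$ (derivations extended to $\mathcal F$), $\mathcal B^{\mathfrak v}=\{b\in\mathcal B: D_x(b)=0\ \forall x\in\mathfrak v\}$. The group $U$ acts on $\mathcal A$ by $g(a)=\exp(D_x)(a)$ for $g=\exp(x)$; the $U$-invariants coincide with the $\mathfrak u$-invariants. A $U$-projector is an algebra homomorphism $\mathcal A\to\mathcal F^U$ that is identical on $\mathcal A^U$. Construction. Fix a chain of ideals $\mathfrak u=\mathfrak u_n\supset\mathfrak u_{n-1}\supset\cdots\supset\mathfrak u_1\supset\mathfrak u_0=\{0\}$ of $\mathfrak u$ with $\mathfrak u_{i}$ of codimension $1$ in $\mathfrak u_{i+1}$. Put $i_0=0$, $\mathcal A_0=\mathcal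 A$ (so $\mathcal A_0^{\mathfrak u_{i_0}}=\mathcal A$). Inductively for $k\ge 1$, if $\mathcal A_{k-1}^{\mathfrak u}\ne\mathcal A_{k-1}^{\mathfrak u_{i_{k-1}}}$, let $i_k$ be the least index with $\mathcal A_{k-1}^{\mathfrak u_{i_k}}\neq \mathcal A_{k-1}^{\mathfrak u_{i_{k-1}}}$ and fix $x_{i_k}\in\mathfrak u_{i_k}\setminus\mathfrak u_{i_k-1}$. There exist $a_{k,1}\in\mathcal A_{k-1}^{\mathfrak u_{i_{k-1}}}$ and $0\ne a_{k,0}\in\mathcal A_{k-1}^{\mathfrak u}$ with $D_{x_{i_k}}(a_{k,1})=a_{k,0}$; fix such elements. Let $\mathcal A_k=\mathcal A_{k-1}[a_{k,0}^{-1}]\subset\mathcal F$ (to which all $D_x$ extend as locally nilpotent derivations), $Q_k=a_{k,1}a_{k,0}^{-1}$, and define $$S_k:\mathcal A_{k-1}^{\mathfrak u_{i_{k-1}}}\to\mathcal A_k^{\mathfrak u_{i_k}},\qquad S_k(a)=\sum_{j\ge 0}(-1)^jD_{x_{i_k}}^j(a)\frac{Q_k^j}{j!}.$$ The process stops after finitely many steps, say at $k=m$, when $\mathcal A_m^{\mathfrak u}=\mathcal A_m^{\mathfrak u_{i_m}}$. Here $1\le i_1<i_2<\dots<i_m\le n$. Put $\mathcal A_*=\mathcal A_m$, the localization of $\mathcal A$ with respect to the denominators generated by $a_{1,0},\dots,a_{m,0}$. In the composition $P$, each $S_k$ takes values in $\mathcal A_k^{\mathfrak u_{i_k}}$, the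 domain of $S_{k+1}$. *)

theory Defs
  imports "HOL-Computational_Algebra.Polynomial_Factorial" "HOL-Library.Groups_Big_Fun"
begin

section \<open>Nilpotent Lie algebras\<close>

locale lie_algebra = vector_space scale
  for scale :: "'k::field \<Rightarrow> 'u::ab_group_add \<Rightarrow> 'u" +
  fixes bracket :: "'u \<Rightarrow> 'u \<Rightarrow> 'u"
  assumes linear_left: "Vector_Spaces.linear scale scale (\<lambda>x. bracket x y)"
    and linear_right: "Vector_Spaces.linear scale scale (\<lambda>y. bracket x y)"
    and alternating: "bracket x x = 0"
    and jacobi: "bracket x (bracket y z) + bracket y (bracket z x) + bracket z (bracket x y) = 0"
begin

definition ideal :: "'u set \<Rightarrow> bool" where
  "ideal I \<longleftrightarrow> subspace I \<and> (\<forall>x. \<forall>y\<in>I. bracket x y \<in> I)"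

primrec lower_central_series :: "nat \<Rightarrow> 'u set" where
  "lower_central_series 0 = UNIV"
| "lower_central_series (Suc k) = span {bracket x y | x y. y \<in> lower_central_series k}"

definition nilpotent :: bool where
  "nilpotent \<longleftrightarrow> (\<exists>k. lower_central_series k = {0})"

definition ideal_chain :: "nat \<Rightarrow> (nat \<Rightarrow> 'u set) \<Rightarrow> bool" where
  "ideal_chain n \<uu> \<longleftrightarrow> \<uu> 0 = {0} \<and> \<uu> n = UNIV \<and> (\<forall>i\<le>n. ideal (\<uu> i)) \<and>
     (\<forall>i<n. \<uu> i \<subseteq> \<uu> (Suc i) \<and> dim (\<uu> (Suc i)) = dim (\<uu> i) + 1)"

end

section \<open>Commutative algebras and derivations\<close>

locale comm_algebra = vector_space scale
  for scale :: "'k::field \<Rightarrow> 'a::comm_ring_1 \<Rightarrow> 'a" +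
  assumes scale_mult_left: "scale c a * b = scale c (a * b)"

definition is_subalgebra :: "('k::field \<Rightarrow> 'a::comm_ring_1 \<Rightarrow> 'a) \<Rightarrow> 'a set \<Rightarrow> bool" where
  "is_subalgebra scale B \<longleftrightarrow>
     module.subspace scale B \<and> 1 \<in> B \<and> (\<forall>a\<in>B. \<forall>b\<in>B. a * b \<in> B)"

definition finitely_generated_algebra :: "('k::field \<Rightarrow> 'a::comm_ring_1 \<Rightarrow> 'a) \<Rightarrow> bool" where
  "finitely_generated_algebra scale \<longleftrightarrow> (\<exists>G. finite G \<and> is_subalgebra scale hull G = UNIV)"

definition algebra_hom ::
  "('k::field \<Rightarrow> 'a::comm_ring_1 \<Rightarrow> 'a) \<Rightarrow> ('k \<Rightarrow> 'b::comm_ring_1 \<Rightarrow> 'b) \<Rightarrow> ('a \<Rightarrow> 'b) \<Rightarrow> bool" where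
  "algebra_hom scale scale' f \<longleftrightarrow>
     Vector_Spaces.linear scale scale' f \<and> f 1 = 1 \<and> (\<forall>a b. f (a * b) = f a * f b)"

definition derivation :: "('k::field \<Rightarrow> 'a::comm_ring_1 \<Rightarrow> 'a) \<Rightarrow> ('a \<Rightarrow> 'a) \<Rightarrow> bool" where
  "derivation scale d \<longleftrightarrow>
     Vector_Spaces.linear scale scale d \<and> (\<forall>a b. d (a * b) = d a * b + a * d b)"

definition locally_nilpotent :: "('a::zero \<Rightarrow> 'a) \<Rightarrow> bool" where
  "locally_nilpotent d \<longleftrightarrow> (\<forall>a. \<exists>n. (d ^^ n) a = 0)"

definition lie_action_by_derivations ::
  "('k::field \<Rightarrow> 'u::ab_group_add \<Rightarrow> 'u) \<Rightarrow> ('u \<Rightarrow> 'u \<Rightarrow> 'u) \<Rightarrow>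
   ('k \<Rightarrow> 'a::comm_ring_1 \<Rightarrow> 'a) \<Rightarrow> ('u \<Rightarrow> 'a \<Rightarrow> 'a) \<Rightarrow> bool" where
  "lie_action_by_derivations scaleU bracket scaleA D \<longleftrightarrow>
     (\<forall>x. derivation scaleA (D x)) \<and>
     (\<forall>a. Vector_Spaces.linear scaleU scaleA (\<lambda>x. D x a)) \<and>
     (\<forall>x y a. D (bracket x y) a = D x (D y a) - D y (D x a))"

definition invariants :: "('u \<Rightarrow> 'b \<Rightarrow> 'b::zero) \<Rightarrow> 'u set \<Rightarrow> 'b set \<Rightarrow> 'b set" where
  "invariants D \<vv> B = {b \<in> B. \<forall>x\<in>\<vv>. D x b = 0}"

section \<open>Extension to the field of fractions\<close>

definition frac_scale :: "('k::field \<Rightarrow> 'a::idom \<Rightarrow> 'a) \<Rightarrow> 'k \<Rightarrow> 'a fract \<Rightarrow> 'a fract" where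
  "frac_scale scale c q = to_fract (scale c 1) * q"

text \<open>The quotient rule. The value does not depend on the representing fraction when \<open>d\<close> is
  a derivation, by \<open>frac_deriv_Fract\<close> below.\<close>

definition frac_deriv :: "('a::idom \<Rightarrow> 'a) \<Rightarrow> 'a fract \<Rightarrow> 'a fract" where
  "frac_deriv d q =
     (THE r. \<exists>a b. b \<noteq> 0 \<and> q = Fract a b \<and> r = Fract (d a * b - a * d b) (b * b))"

lemma frac_deriv_Fract:
  assumes "derivation scale d" and "b \<noteq> 0"
  shows "frac_deriv d (Fract a b) = Fract (d a * b - a * d b) (b * b)"
  unfolding frac_deriv_def
proof (rule the_equality)
  show "\<exists>a' b'. b' \<noteq> 0 \<and> Fract a b = Fract a' b' \<and>
      Fract (d a * b - a * d b) (b * b) = Fract (d a' * b' - a' * d b') (b' * b')"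
    using assms(2) by blast
next
  fix r assume "\<exists>a' b'. b' \<noteq> 0 \<and> Fract a b = Fract a' b' \<and>
      r = Fract (d a' * b' - a' * d b') (b' * b')"
  then obtain a' b' where b': "b' \<noteq> 0" and eq: "Fract a b = Fract a' b'"
    and r: "r = Fract (d a' * b' - a' * d b') (b' * b')" by blast
  have leib: "d (x * y) = d x * y + x * d y" for x y
    using assms(1) by (simp add: derivation_def)
  have cross: "a * b' = a' * b" using eq assms(2) b' by (simp add: eq_fract)
  have dcross: "d a * b' + a * d b' = d a' * b + a' * d b"
    using arg_cong[OF cross, of d] by (simp add: leib)
  have "(d a' * b' - a' * d b') * (b * b) = (d a * b - a * d b) * (b' * b')"
    using cross dcross by algebra
  then show "r = Fract (d a * b - a * d b) (b * b)"
    using assms(2) b' by (simp add: r eq_fract)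
qed

text \<open>The extension of an injective ring endomorphism to fractions, \<open>f (a / b) = f a / f b\<close>.\<close>

definition frac_map :: "('a::idom \<Rightarrow> 'a) \<Rightarrow> 'a fract \<Rightarrow> 'a fract" where
  "frac_map f q = (THE r. \<exists>a b. b \<noteq> 0 \<and> q = Fract a b \<and> r = Fract (f a) (f b))"

lemma frac_map_Fract:
  assumes mult: "\<And>a b. f (a * b) = f a * f b" and nz: "\<And>a. a \<noteq> 0 \<Longrightarrow> f a \<noteq> 0" and "b \<noteq> 0"
  shows "frac_map f (Fract a b) = Fract (f a) (f b)"
  unfolding frac_map_def
proof (rule the_equality)
  show "\<exists>a' b'. b' \<noteq> 0 \<and> Fract a b = Fract a' b' \<and> Fract (f a) (f b) = Fract (f a') (f b')"
    using assms(3) by blast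
next
  fix r assume "\<exists>a' b'. b' \<noteq> 0 \<and> Fract a b = Fract a' b' \<and> r = Fract (f a') (f b')"
  then obtain a' b' where b': "b' \<noteq> 0" and eq: "Fract a b = Fract a' b'"
    and r: "r = Fract (f a') (f b')" by blast
  have "a' * b = a * b'" using eq assms(3) b' by (simp add: eq_fract)
  then have "f a' * f b = f a * f b'" by (metis mult)
  then show "r = Fract (f a) (f b)" using nz assms(3) b' by (simp add: r eq_fract)
qed

section \<open>The unipotent group and its projectors\<close>

text \<open>The action of \<open>exp x\<close>. For locally nilpotent \<open>D x\<close> the series has finitely many nonzero
  terms, and \<open>Sum_any\<close> adds exactly those.\<close>

definition exp_action ::
  "('k::field_char_0 \<Rightarrow> 'a::comm_ring_1 \<Rightarrow> 'a) \<Rightarrow> ('u \<Rightarrow> 'a \<Rightarrow> 'a) \<Rightarrow> 'u \<Rightarrow> 'a \<Rightarrow> 'a" where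
  "exp_action scale D x a = Sum_any (\<lambda>j. scale (1 / fact j) ((D x ^^ j) a))"

text \<open>Since every element of \<open>U\<close> is \<open>exp x\<close> for some \<open>x\<close> in the Lie algebra, \<open>U\<close>-invariance is
  invariance under all \<open>exp x\<close>. On fractions \<open>U\<close> acts by the extended automorphisms.\<close>

definition U_invariants ::
  "('k::field_char_0 \<Rightarrow> 'a::comm_ring_1 \<Rightarrow> 'a) \<Rightarrow> ('u \<Rightarrow> 'a \<Rightarrow> 'a) \<Rightarrow> 'a set" where
  "U_invariants scale D = {a. \<forall>x. exp_action scale D x a = a}"

definition U_invariant_fractions ::
  "('k::field_char_0 \<Rightarrow> 'a::idom \<Rightarrow> 'a) \<Rightarrow> ('u \<Rightarrow> 'a \<Rightarrow> 'a) \<Rightarrow> 'a fract set" where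
  "U_invariant_fractions scale D = {q. \<forall>x. frac_map (exp_action scale D x) q = q}"

definition U_projector ::
  "('k::field_char_0 \<Rightarrow> 'a::idom \<Rightarrow> 'a) \<Rightarrow> ('u \<Rightarrow> 'a \<Rightarrow> 'a) \<Rightarrow> ('a \<Rightarrow> 'a fract) \<Rightarrow> bool" where
  "U_projector scale D P \<longleftrightarrow>
     algebra_hom scale (frac_scale scale) P \<and>
     range P \<subseteq> U_invariant_fractions scale D \<and>
     (\<forall>a\<in>U_invariants scale D. P a = to_fract a)"

section \<open>The construction\<close>

text \<open>All algebras of the construction are subsets of the field of fractions, and
  \<open>a0 k\<close>, \<open>a1 k\<close>, \<open>xi k\<close> stand for $a_{k,0}$, $a_{k,1}$, $x_{i_k}$ with \<open>k \<ge> 1\<close>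
  (the values at \<open>0\<close> are not used).\<close>

abbreviation frac_D :: "('u \<Rightarrow> 'a::idom \<Rightarrow> 'a) \<Rightarrow> 'u \<Rightarrow> 'a fract \<Rightarrow> 'a fract" where
  "frac_D D \<equiv> \<lambda>x. frac_deriv (D x)"

primrec localized ::
  "('k::field \<Rightarrow> 'a::idom \<Rightarrow> 'a) \<Rightarrow> (nat \<Rightarrow> 'a fract) \<Rightarrow> nat \<Rightarrow> 'a fract set" where
  "localized scale a0 0 = range to_fract"
| "localized scale a0 (Suc k) =
     is_subalgebra (frac_scale scale) hull insert (inverse (a0 (Suc k))) (localized scale a0 k)"

text \<open>The map $S_k$, as a total function on the field of fractions. On its domain the sum is
  finite.\<close>

definition S_map ::
  "('u \<Rightarrow> 'a::idom \<Rightarrow> 'a) \<Rightarrow> (nat \<Rightarrow> 'u) \<Rightarrow> (nat \<Rightarrow> 'a fract) \<Rightarrow> (nat \<Rightarrow> 'a fract) \<Rightarrow>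
   nat \<Rightarrow> 'a fract \<Rightarrow> 'a fract" where
  "S_map D xi a0 a1 k a =
     (let Q = a1 k * inverse (a0 k)
      in Sum_any (\<lambda>j. (- 1) ^ j * (frac_D D (xi k) ^^ j) a * (Q ^ j / of_nat (fact j))))"

primrec S_composition ::
  "('u \<Rightarrow> 'a::idom \<Rightarrow> 'a) \<Rightarrow> (nat \<Rightarrow> 'u) \<Rightarrow> (nat \<Rightarrow> 'a fract) \<Rightarrow> (nat \<Rightarrow> 'a fract) \<Rightarrow>
   nat \<Rightarrow> 'a fract \<Rightarrow> 'a fract" where
  "S_composition D xi a0 a1 0 = id"
| "S_composition D xi a0 a1 (Suc k) = S_map D xi a0 a1 (Suc k) \<circ> S_composition D xi a0 a1 k"

definition P_map ::
  "('u \<Rightarrow> 'a::idom \<Rightarrow> 'a) \<Rightarrow> (nat \<Rightarrow> 'u) \<Rightarrow> (nat \<Rightarrow> 'a fract) \<Rightarrow> (nat \<Rightarrow> 'a fract) \<Rightarrow>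
   nat \<Rightarrow> 'a \<Rightarrow> 'a fract" where
  "P_map D xi a0 a1 m a = S_composition D xi a0 a1 m (to_fract a)"

text \<open>A completed run of the construction, with step \<open>Suc k\<close> leading from \<open>localized scaleA a0 k\<close>
  to \<open>localized scaleA a0 (Suc k)\<close>. The least index is taken among those above \<open>i k\<close>: for
  \<open>j < i k\<close> the invariants of the larger algebra can differ again (for \<open>j = 0\<close> they are the whole
  algebra).\<close>

locale projector_construction =
  fixes scaleU :: "'k::field_char_0 \<Rightarrow> 'u::ab_group_add \<Rightarrow> 'u"
    and bracket :: "'u \<Rightarrow> 'u \<Rightarrow> 'u"
    and scaleA :: "'k \<Rightarrow> 'a::idom \<Rightarrow> 'a"
    and D :: "'u \<Rightarrow> 'a \<Rightarrow> 'a"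
    and n :: nat and \<uu> :: "nat \<Rightarrow> 'u set"
    and m :: nat and i :: "nat \<Rightarrow> nat" and xi :: "nat \<Rightarrow> 'u"
    and a0 a1 :: "nat \<Rightarrow> 'a fract"
  assumes chain: "lie_algebra.ideal_chain scaleU bracket n \<uu>"
    and start: "i 0 = 0"
    and continue: "k < m \<Longrightarrow>
      invariants (frac_D D) UNIV (localized scaleA a0 k)
        \<noteq> invariants (frac_D D) (\<uu> (i k)) (localized scaleA a0 k)"
    and least_index: "k < m \<Longrightarrow>
      i (Suc k) = (LEAST j. i k < j \<and> j \<le> n \<and>
        invariants (frac_D D) (\<uu> j) (localized scaleA a0 k)
          \<noteq> invariants (frac_D D) (\<uu> (i k)) (localized scaleA a0 k))"
    and xi: "k < m \<Longrightarrow> xi (Suc k) \<in> \<uu> (i (Suc k)) - \<uu> (i (Suc k) - 1)"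
    and a1: "k < m \<Longrightarrow>
      a1 (Suc k) \<in> invariants (frac_D D) (\<uu> (i k)) (localized scaleA a0 k)"
    and a0: "k < m \<Longrightarrow> a0 (Suc k) \<in> invariants (frac_D D) UNIV (localized scaleA a0 k)"
    and a0_nonzero: "k < m \<Longrightarrow> a0 (Suc k) \<noteq> 0"
    and D_a1: "k < m \<Longrightarrow> frac_D D (xi (Suc k)) (a1 (Suc k)) = a0 (Suc k)"
    and stop: "invariants (frac_D D) UNIV (localized scaleA a0 m)
        = invariants (frac_D D) (\<uu> (i m)) (localized scaleA a0 m)"

end

theory Submission
  imports Defs
begin

text \<open>
  The reason is the slice construction. If \<open>d\<close> is a locally nilpotent derivation of a
  commutative \<open>\<rat>\<close>-algebra and \<open>d Q = 1\<close>, then \<open>a \<mapsto> \<Sum>j. (- Q) ^ j / fact j * d ^ j (a)\<close>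
  is the exponential series of \<open>t d\<close> evaluated at \<open>t = - Q\<close>. It is multiplicative by the Leibniz
  rule (\<open>taylor_sum_mult\<close>), its values are killed by \<open>d\<close> because the derivative telescopes
  (\<open>taylor_sum_in_kernel\<close>), and it fixes the kernel of \<open>d\<close>.

  Each \<open>S_k\<close> is such a map, with \<open>d\<close> the action of \<open>x = x_{i_k}\<close>. Let \<open>j = i_k\<close>. By minimality
  of \<open>j\<close> the domain of \<open>S_k\<close> is already the set of invariants of \<open>\<uu>_{j - 1}\<close>
  (\<open>next_index_if\<close>). It is stable under \<open>x\<close> since the members of the chain are ideals, and
  \<open>Q_k\<close> is \<open>\<uu>_{j - 1}\<close>-invariant, so the values of \<open>S_k\<close> are invariant under \<open>\<uu>_{j - 1}\<close> and
  under \<open>x\<close>, which together span \<open>\<uu>_j\<close> (\<open>S_map_in_stage\<close>). Hence the composition takes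
  values in the invariants of \<open>\<uu>_{i_m}\<close>, which are the \<open>\<uu>\<close>-invariants by the stopping condition.

  The passage from \<open>\<uu>\<close> to \<open>U\<close> has two halves. An element of \<open>\<A>\<close> fixed by all
  exponentials is killed by all derivations, by looking at the last nonvanishing iterates
  (\<open>U_invariants_subset\<close>). A fraction killed by all derivations is fixed by the extended
  exponentials (\<open>invariant_fractions_U_invariant\<close>).
\<close>

section \<open>Derivations of commutative rings\<close>

locale ring_derivation =
  fixes d :: "'b::comm_ring_1 \<Rightarrow> 'b"
  assumes add: "d (a + b) = d a + d b"
    and leibniz: "d (a * b) = d a * b + a * d b"
begin

lemma zero [simp]: "d 0 = 0"
  using add[of 0 0] by simp

lemma one [simp]: "d 1 = 0"
  using leibniz[of 1 1] by simp

lemma minus: "d (- a) = - d a"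
  using add[of a "- a"] by (simp add: eq_neg_iff_add_eq_0 add.commute)

lemma sum: "d (sum f A) = (\<Sum>a\<in>A. d (f a))"
  by (induction A rule: infinite_finite_induct) (simp_all add: add)

lemma of_nat [simp]: "d (of_nat k) = 0"
  by (induction k) (simp_all add: add)

lemma constant_power: "d a = 0 \<Longrightarrow> d (a ^ k) = 0"
  by (induction k) (simp_all add: leibniz)

lemma iterate_zero [simp]: "(d ^^ k) 0 = 0"
  by (induction k) simp_all

lemma iterate_add: "(d ^^ k) (a + b) = (d ^^ k) a + (d ^^ k) b"
  by (induction k) (simp_all add: add)

lemma iterate_sum: "(d ^^ k) (sum f A) = (\<Sum>a\<in>A. (d ^^ k) (f a))"
  by (induction k) (simp_all add: sum)

lemma iterate_constant_mult: "d c = 0 \<Longrightarrow> (d ^^ k) (c * a) = c * (d ^^ k) a"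
  by (induction k) (simp_all add: leibniz)

lemma iterate_vanishes_mono:
  assumes "(d ^^ k) a = 0" and "k \<le> l"
  shows "(d ^^ l) a = 0"
proof -
  have "(d ^^ l) a = (d ^^ (l - k)) ((d ^^ k) a)"
    using assms(2) by (metis comp_apply funpow_add le_add_diff_inverse2)
  then show ?thesis using assms(1) by simp
qed

lemma iterate_leibniz:
  "(d ^^ k) (a * b) = (\<Sum>j\<le>k. of_nat (k choose j) * ((d ^^ j) a * (d ^^ (k - j)) b))"
proof (induction k)
  case 0
  show ?case by simp
next
  case (Suc k)
  let ?t = "\<lambda>j l. (d ^^ j) a * (d ^^ l) b"
  have "(d ^^ Suc k) (a * b) = (\<Sum>j\<le>k. d (of_nat (k choose j) * ?t j (k - j)))"
    by (simp add: Suc sum)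
  also have "\<dots> = (\<Sum>j\<le>k. of_nat (k choose j) * ?t (Suc j) (k - j))
      + (\<Sum>j\<le>k. of_nat (k choose j) * ?t j (Suc k - j))"
    by (simp add: leibniz distrib_left sum.distrib Suc_diff_le)
  also have "(\<Sum>j\<le>k. of_nat (k choose j) * ?t j (Suc k - j))
      = ?t 0 (Suc k) + (\<Sum>j\<le>k. of_nat (k choose Suc j) * ?t (Suc j) (k - j))"
  proof -
    have "(\<Sum>j\<le>k. of_nat (k choose j) * ?t j (Suc k - j))
        = (\<Sum>j\<le>Suc k. of_nat (k choose j) * ?t j (Suc k - j))"
      by (simp add: binomial_eq_0)
    also have "\<dots> = ?t 0 (Suc k) + (\<Sum>j\<le>k. of_nat (k choose Suc j) * ?t (Suc j) (k - j))"
      by (subst sum.atMost_Suc_shift) simp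
    finally show ?thesis .
  qed
  also have "(\<Sum>j\<le>k. of_nat (k choose j) * ?t (Suc j) (k - j))
      + (?t 0 (Suc k) + (\<Sum>j\<le>k. of_nat (k choose Suc j) * ?t (Suc j) (k - j)))
      = (\<Sum>j\<le>Suc k. of_nat (Suc k choose j) * ?t j (Suc k - j))"
    by (subst sum.atMost_Suc_shift)
      (simp add: sum.distrib distrib_right add.commute add.left_commute)
  finally show ?case .
qed

lemma iterate_mult_vanishes:
  assumes "(d ^^ k) a = 0" and "(d ^^ l) b = 0"
  shows "(d ^^ (k + l)) (a * b) = 0"
  unfolding iterate_leibniz
proof (rule sum.neutral, rule ballI)
  fix j assume "j \<in> {..k + l}"
  show "of_nat (k + l choose j) * ((d ^^ j) a * (d ^^ (k + l - j)) b) = 0"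
  proof (cases "k \<le> j")
    case True
    then show ?thesis using iterate_vanishes_mono[OF assms(1)] by simp
  next
    case False
    then have "l \<le> k + l - j" by simp
    then show ?thesis using iterate_vanishes_mono[OF assms(2)] by simp
  qed
qed

text \<open>Applying this iterate isolates the lowest-order term of a power series in \<open>d\<close> at \<open>a\<close>.\<close>

lemma last_nonzero_iterate:
  assumes "(d ^^ k) a = 0" and "a \<noteq> 0"
  obtains l where "(d ^^ l) a \<noteq> 0" and "(d ^^ Suc l) a = 0"
proof -
  let ?k = "LEAST k. (d ^^ k) a = 0"
  have z: "(d ^^ ?k) a = 0" using assms(1) by (rule LeastI)
  with assms(2) obtain l where l: "?k = Suc l" by (cases ?k) auto
  then have "(d ^^ l) a \<noteq> 0" using not_less_Least[of l "\<lambda>k. (d ^^ k) a = 0"] by auto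
  with z l show thesis using that by metis
qed

end

lemma derivation_imp_ring_derivation:
  assumes "derivation scale d"
  shows "ring_derivation d"
proof
  interpret L: Vector_Spaces.linear scale scale d using assms by (simp add: derivation_def)
  show "d (a + b) = d a + d b" for a b by (rule L.add)
  show "d (a * b) = d a * b + a * d b" for a b using assms by (simp add: derivation_def)
qed

lemma ring_derivation_constant_inverse:
  fixes d :: "'f::field \<Rightarrow> 'f"
  assumes "ring_derivation d" and "d a = 0"
  shows "d (inverse a) = 0"
proof (cases "a = 0")
  case True
  then show ?thesis using assms(2) by simp
next
  case False
  interpret ring_derivation d by fact
  have "a * d (inverse a) = d (a * inverse a)" by (simp add: leibniz assms(2))
  also have "\<dots> = 0" using False by simp
  finally show ?thesis using False by simp
qed

section \<open>Taylor sums\<close>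

definition taylor_sum :: "(nat \<Rightarrow> 'b) \<Rightarrow> ('b::comm_ring_1 \<Rightarrow> 'b) \<Rightarrow> 'b \<Rightarrow> 'b" where
  "taylor_sum w d a = Sum_any (\<lambda>j. w j * (d ^^ j) a)"

text \<open>The multiplicative law of the sequence \<open>t ^ j / fact j\<close>, stated without division so that it
  applies to coefficients in any commutative ring.\<close>

definition divided_powers :: "(nat \<Rightarrow> 'b::comm_ring_1) \<Rightarrow> bool" where
  "divided_powers w \<longleftrightarrow> w 0 = 1 \<and> (\<forall>j l. of_nat (j + l choose j) * w (j + l) = w j * w l)"

lemma divided_powers_intro:
  fixes r :: "nat \<Rightarrow> 'b::comm_ring_1"
  assumes "\<And>j. of_nat (fact j) * r j = 1"
  shows "divided_powers (\<lambda>j. t ^ j * r j)"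
  unfolding divided_powers_def
proof (intro conjI allI)
  show "t ^ 0 * r 0 = 1" using assms[of 0] by simp
next
  fix j l
  have r: "of_nat (j + l choose j) * r (j + l) = r j * r l"
  proof -
    have "fact j * fact l * (j + l choose j) = (fact (j + l) :: nat)"
      using binomial_fact_lemma[of j "j + l"] by simp
    then have f: "of_nat (fact j) * of_nat (fact l) * of_nat (j + l choose j)
        = (of_nat (fact (j + l)) :: 'b)"
      by (metis of_nat_mult)
    have "of_nat (j + l choose j) * r (j + l)
        = of_nat (j + l choose j) * r (j + l) * (of_nat (fact j) * r j) * (of_nat (fact l) * r l)"
      by (simp only: assms mult_1_right)
    also have "\<dots> = (of_nat (fact j) * of_nat (fact l) * of_nat (j + l choose j)) * r (j + l)
        * (r j * r l)"
      by (simp only: ac_simps)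
    also have "\<dots> = r j * r l" by (simp only: f assms mult_1_left)
    finally show ?thesis .
  qed
  have "of_nat (j + l choose j) * (t ^ (j + l) * r (j + l))
      = t ^ (j + l) * (of_nat (j + l choose j) * r (j + l))"
    by (simp only: ac_simps)
  also have "\<dots> = t ^ j * t ^ l * (r j * r l)" by (simp only: r power_add)
  also have "\<dots> = t ^ j * r j * (t ^ l * r l)" by (simp only: ac_simps)
  finally show "of_nat (j + l choose j) * (t ^ (j + l) * r (j + l)) = t ^ j * r j * (t ^ l * r l)" .
qed

context ring_derivation
begin

lemma taylor_sum_eq_sum:
  assumes "(d ^^ k) a = 0"
  shows "taylor_sum w d a = (\<Sum>j<k. w j * (d ^^ j) a)"
  unfolding taylor_sum_def
proof (rule Sum_any.expand_superset)
  show "{j. w j * (d ^^ j) a \<noteq> 0} \<subseteq> {..<k}"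
    using iterate_vanishes_mono[OF assms] by (force simp: not_less[symmetric])
qed simp

lemma taylor_sum_constant:
  assumes "d a = 0"
  shows "taylor_sum w d a = w 0 * a"
  using taylor_sum_eq_sum[of 1 a w] assms by simp

lemma taylor_sum_add:
  assumes "(d ^^ k) a = 0" and "(d ^^ l) b = 0"
  shows "taylor_sum w d (a + b) = taylor_sum w d a + taylor_sum w d b"
proof -
  have a: "(d ^^ (k + l)) a = 0" and b: "(d ^^ (k + l)) b = 0"
    using assms iterate_vanishes_mono by simp_all
  then have ab: "(d ^^ (k + l)) (a + b) = 0" by (simp add: iterate_add)
  show ?thesis
    unfolding taylor_sum_eq_sum[OF a] taylor_sum_eq_sum[OF b] taylor_sum_eq_sum[OF ab]
    by (simp add: iterate_add distrib_left sum.distrib)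
qed

text \<open>With divided powers as coefficients the iterated Leibniz rule becomes the Cauchy product.\<close>

lemma taylor_sum_mult:
  assumes w: "divided_powers w" and a: "(d ^^ k) a = 0" and b: "(d ^^ l) b = 0"
  shows "taylor_sum w d (a * b) = taylor_sum w d a * taylor_sum w d b"
proof -
  let ?f = "\<lambda>j. w j * (d ^^ j) a" and ?g = "\<lambda>j. w j * (d ^^ j) b"
  have coeff: "w r * (of_nat (r choose j) * ((d ^^ j) a * (d ^^ (r - j)) b)) = ?f j * ?g (r - j)"
    if "j \<le> r" for r j
  proof -
    have "of_nat (r choose j) * w r = w j * w (r - j)"
      using w that unfolding divided_powers_def by (metis le_add_diff_inverse)
    then have "of_nat (r choose j) * w r * ((d ^^ j) a * (d ^^ (r - j)) b)
      = w j * w (r - j) * ((d ^^ j) a * (d ^^ (r - j)) b)" by simp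
    then show ?thesis by (simp only: ac_simps)
  qed
  have "taylor_sum w d (a * b) = (\<Sum>r<k + l. w r * (d ^^ r) (a * b))"
    by (rule taylor_sum_eq_sum[OF iterate_mult_vanishes[OF a b]])
  also have "\<dots> = (\<Sum>r<k + l. \<Sum>j\<le>r. ?f j * ?g (r - j))"
    by (simp add: iterate_leibniz sum_distrib_left coeff)
  also have "\<dots> = (\<Sum>(i, j)\<in>{(i, j). i + j < k + l}. ?f i * ?g j)"
    by (rule sum.triangle_reindex[symmetric])
  also have "\<dots> = (\<Sum>(i, j)\<in>{..<k} \<times> {..<l}. ?f i * ?g j)"
  proof (rule sum.mono_neutral_right)
    show "finite {(i, j). i + j < k + l}"
      by (rule finite_subset[of _ "{..<k + l} \<times> {..<k + l}"]) auto
    show "{..<k} \<times> {..<l} \<subseteq> {(i, j). i + j < k + l}" by auto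
    have "?f i * ?g j = 0" if "\<not> (i < k \<and> j < l)" for i j
      using that iterate_vanishes_mono[OF a, of i] iterate_vanishes_mono[OF b, of j]
      by (cases "i < k") (simp_all add: not_less)
    then show "\<forall>p\<in>{(i, j). i + j < k + l} - {..<k} \<times> {..<l}. (case p of (i, j) \<Rightarrow> ?f i * ?g j) = 0"
      by auto
  qed
  also have "\<dots> = taylor_sum w d a * taylor_sum w d b"
    by (simp add: taylor_sum_eq_sum[OF a] taylor_sum_eq_sum[OF b] sum_product
        sum.cartesian_product)
  finally show ?thesis .
qed

text \<open>The derivative telescopes: in the Leibniz rule, \<open>w j * (d ^^ Suc j) a\<close> from the term of index
  \<open>j\<close> cancels \<open>d (w (Suc j)) * (d ^^ Suc j) a\<close> from the next one. The condition on \<open>w\<close> holds for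
  the divided powers of \<open>- Q\<close> if \<open>d Q = 1\<close>.\<close>

lemma taylor_sum_in_kernel:
  assumes w0: "d (w 0) = 0" and w: "\<And>j. d (w (Suc j)) = - w j" and a: "(d ^^ k) a = 0"
  shows "d (taylor_sum w d a) = 0"
proof -
  have "d (\<Sum>j<Suc l. w j * (d ^^ j) a) = w l * (d ^^ Suc l) a" for l
  proof (induction l)
    case 0
    show ?case by (simp add: leibniz w0)
  next
    case (Suc l)
    then show ?case by (simp add: add leibniz w)
  qed
  moreover have z: "(d ^^ Suc k) a = 0" using a by simp
  ultimately show ?thesis using taylor_sum_eq_sum[OF z, of w] by (metis mult_zero_right)
qed

text \<open>Since \<open>(d ^^ (k + j)) a = 0\<close> for \<open>j > 0\<close>, only the term with the coefficient \<open>w 0 = 1\<close>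
  survives.\<close>

lemma iterate_taylor_sum:
  assumes w0: "w 0 = 1" and w: "\<And>j. d (w j) = 0" and a: "(d ^^ Suc k) a = 0"
  shows "(d ^^ k) (taylor_sum w d a) = (d ^^ k) a"
proof -
  have "(d ^^ k) (taylor_sum w d a) = (\<Sum>j<Suc k. w j * (d ^^ (k + j)) a)"
    by (simp only: taylor_sum_eq_sum[OF a] iterate_sum iterate_constant_mult[OF w] funpow_add comp_apply)
  also have "\<dots> = (\<Sum>j<Suc k. if j = 0 then (d ^^ k) a else 0)"
    using iterate_vanishes_mono[OF a] by (intro sum.cong) (auto simp: w0)
  also have "\<dots> = (d ^^ k) a" by simp
  finally show ?thesis .
qed

lemma taylor_sum_nonzero:
  assumes w0: "w 0 = 1" and w: "\<And>j. d (w j) = 0" and a: "(d ^^ k) a = 0" "a \<noteq> 0"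
  shows "taylor_sum w d a \<noteq> 0"
proof -
  obtain l where "(d ^^ l) a \<noteq> 0" "(d ^^ Suc l) a = 0" using last_nonzero_iterate[OF a] .
  then show ?thesis using iterate_taylor_sum[where w = w and a = a and k = l] w0 w by force
qed

text \<open>If \<open>a\<close> is fixed, the terms of order at least one add up to zero. Were \<open>d a\<close> nonzero, let
  \<open>(d ^^ l) (d a)\<close> be its last nonzero iterate: applying \<open>d ^^ l\<close> to these terms leaves exactly
  that iterate, which would have to vanish.\<close>

lemma taylor_sum_fixed_imp_constant:
  assumes w0: "w 0 = 1" and w1: "w 1 = 1" and w: "\<And>j. d (w j) = 0" and a: "(d ^^ k) a = 0"
    and fixed: "taylor_sum w d a = a"
  shows "d a = 0"
proof (rule ccontr)
  assume "d a \<noteq> 0"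
  moreover have "(d ^^ k) (d a) = 0" using a by (metis funpow_swap1 zero)
  ultimately obtain l where l: "(d ^^ l) (d a) \<noteq> 0" "(d ^^ Suc l) (d a) = 0"
    using last_nonzero_iterate by blast
  then have z: "(d ^^ Suc (Suc l)) a = 0"
    by (metis comp_apply funpow_Suc_right)
  have "(d ^^ l) (taylor_sum w d a) = (\<Sum>j<Suc (Suc l). w j * (d ^^ (l + j)) a)"
    by (simp only: taylor_sum_eq_sum[OF z] iterate_sum iterate_constant_mult[OF w] funpow_add comp_apply)
  also have "\<dots> = (d ^^ l) a + ((d ^^ Suc l) a + (\<Sum>j<l. w (Suc (Suc j)) * (d ^^ (l + Suc (Suc j))) a))"
    by (simp only: sum.lessThan_Suc_shift) (simp add: w0 w1[simplified])
  also have "(\<Sum>j<l. w (Suc (Suc j)) * (d ^^ (l + Suc (Suc j))) a) = 0"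
    using iterate_vanishes_mono[OF z] by (intro sum.neutral) (simp del: funpow.simps)
  finally have "(d ^^ Suc l) a = 0" using fixed by simp
  with l(1) show False by (metis comp_apply funpow_Suc_right)
qed

end

section \<open>Derivations of the field of fractions\<close>

lemma ring_derivation_frac_deriv:
  fixes d :: "'a::idom \<Rightarrow> 'a"
  assumes d: "derivation scale d"
  shows "ring_derivation (frac_deriv d)"
proof
  interpret ring_derivation d using derivation_imp_ring_derivation[OF d] .
  fix p q :: "'a fract"
  obtain a b where p: "p = Fract a b" and b: "b \<noteq> 0" by (cases p)
  obtain a' b' where q: "q = Fract a' b'" and b': "b' \<noteq> 0" by (cases q)
  show "frac_deriv d (p + q) = frac_deriv d p + frac_deriv d q"
    using b b' by (simp add: p q frac_deriv_Fract[OF d] eq_fract add leibniz)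
      (simp add: algebra_simps)
  show "frac_deriv d (p * q) = frac_deriv d p * q + p * frac_deriv d q"
    using b b' by (simp add: p q frac_deriv_Fract[OF d] eq_fract add leibniz)
      (simp add: algebra_simps)
qed

lemma frac_deriv_to_fract:
  assumes "derivation scale d"
  shows "frac_deriv d (to_fract a) = to_fract (d a)"
proof -
  interpret ring_derivation d using derivation_imp_ring_derivation[OF assms] .
  show ?thesis by (simp add: to_fract_def frac_deriv_Fract[OF assms])
qed

lemma frac_deriv_iterate_to_fract:
  assumes "derivation scale d"
  shows "(frac_deriv d ^^ k) (to_fract a) = to_fract ((d ^^ k) a)"
  by (induction k) (simp_all add: frac_deriv_to_fract[OF assms])

text \<open>Uniqueness of the extension: \<open>q b = a\<close> and the Leibniz rule determine \<open>d q\<close>. All identities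
  between the extended derivations are reduced to the algebra itself in this way.\<close>

lemma ring_derivation_fract_eqI:
  fixes d e :: "'a::idom fract \<Rightarrow> 'a fract"
  assumes "ring_derivation d" and "ring_derivation e" and eq: "\<And>a. d (to_fract a) = e (to_fract a)"
  shows "d q = e q"
proof -
  interpret d: ring_derivation d by fact
  interpret e: ring_derivation e by fact
  obtain a b where q: "q = Fract a b" and b: "b \<noteq> 0" by (cases q)
  then have qb: "q * to_fract b = to_fract a" by (simp add: to_fract_def eq_fract)
  have "d q * to_fract b = d (to_fract a) - q * d (to_fract b)"
    by (simp add: qb[symmetric] d.leibniz)
  also have "\<dots> = e (to_fract a) - q * e (to_fract b)" by (simp add: eq)
  also have "\<dots> = e q * to_fract b" by (simp add: qb[symmetric] e.leibniz)
  finally show ?thesis using b by simp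
qed

lemma to_fract_of_nat: "to_fract (of_nat k) = of_nat k"
  by (induction k) simp_all

lemma ring_derivation_plus:
  "ring_derivation d \<Longrightarrow> ring_derivation e \<Longrightarrow> ring_derivation (\<lambda>a. d a + e a)"
  by (simp add: ring_derivation_def algebra_simps)

lemma ring_derivation_scaled:
  "ring_derivation d \<Longrightarrow> ring_derivation (\<lambda>a. c * d a)"
  by (simp add: ring_derivation_def algebra_simps)

lemma ring_derivation_commutator:
  "ring_derivation d \<Longrightarrow> ring_derivation e \<Longrightarrow> ring_derivation (\<lambda>a. d (e a) - e (d a))"
  by (simp add: ring_derivation_def algebra_simps)

section \<open>The action on fractions\<close>

lemma (in comm_algebra) scale_one_mult: "scale c 1 * a = scale c a"
  by (simp add: scale_mult_left)

lemma comm_algebra_frac_scale: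
  fixes scale :: "'k::field \<Rightarrow> 'a::idom \<Rightarrow> 'a"
  assumes "comm_algebra scale"
  shows "comm_algebra (frac_scale scale)"
proof -
  interpret comm_algebra scale by fact
  show ?thesis
    by unfold_locales
      (simp_all add: frac_scale_def distrib_left distrib_right scale_left_distrib scale_one_mult
        flip: mult.assoc to_fract_mult)
qed

locale lie_action =
  U: lie_algebra scaleU bracket + A: comm_algebra scaleA
  for scaleU :: "'k::field_char_0 \<Rightarrow> 'u::ab_group_add \<Rightarrow> 'u"
    and bracket :: "'u \<Rightarrow> 'u \<Rightarrow> 'u"
    and scaleA :: "'k \<Rightarrow> 'a::idom \<Rightarrow> 'a" +
  fixes D :: "'u \<Rightarrow> 'a \<Rightarrow> 'a"
  assumes action: "lie_action_by_derivations scaleU bracket scaleA D"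
    and loc_nilpotent: "locally_nilpotent (D x)"
begin

lemma derivation_D: "derivation scaleA (D x)"
  using action by (simp add: lie_action_by_derivations_def)

end

sublocale lie_action \<subseteq> F: comm_algebra "frac_scale scaleA"
  by (rule comm_algebra_frac_scale) unfold_locales

sublocale lie_action \<subseteq> DA: ring_derivation "D x" for x
  by (rule derivation_imp_ring_derivation[OF derivation_D])

sublocale lie_action \<subseteq> DF: ring_derivation "frac_D D x" for x
  by (rule ring_derivation_frac_deriv[OF derivation_D])

context lie_action
begin

lemma D_nilpotent:
  obtains k where "(D x ^^ k) a = 0"
  using loc_nilpotent unfolding locally_nilpotent_def by blast

lemma D_scale_one [simp]: "D x (scaleA c 1) = 0"
proof -
  interpret L: Vector_Spaces.linear scaleA scaleA "D x"
    using derivation_D by (simp add: derivation_def)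
  show ?thesis by (simp add: L.scale)
qed

lemmas frac_D_to_fract = frac_deriv_to_fract[OF derivation_D]

lemma frac_D_frac_scale: "frac_D D x (frac_scale scaleA c q) = frac_scale scaleA c (frac_D D x q)"
  by (simp add: frac_scale_def DF.leibniz frac_D_to_fract)

lemma iterate_frac_D_frac_scale:
  "(frac_D D x ^^ k) (frac_scale scaleA c q) = frac_scale scaleA c ((frac_D D x ^^ k) q)"
  by (induction k) (simp_all add: frac_D_frac_scale)

lemma frac_D_add_left: "frac_D D (x + y) q = frac_D D x q + frac_D D y q"
proof (rule ring_derivation_fract_eqI[where d = "frac_D D (x + y)"
      and e = "\<lambda>q. frac_D D x q + frac_D D y q"])
  show "ring_derivation (\<lambda>q. frac_D D x q + frac_D D y q)"
    by (rule ring_derivation_plus) unfold_locales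
  fix a
  interpret L: Vector_Spaces.linear scaleU scaleA "\<lambda>x. D x a"
    using action by (simp add: lie_action_by_derivations_def)
  show "frac_D D (x + y) (to_fract a) = frac_D D x (to_fract a) + frac_D D y (to_fract a)"
    by (simp add: frac_D_to_fract L.add)
qed unfold_locales

lemma frac_D_scale_left: "frac_D D (scaleU c x) q = frac_scale scaleA c (frac_D D x q)"
  unfolding frac_scale_def
proof (rule ring_derivation_fract_eqI[where d = "frac_D D (scaleU c x)"
      and e = "\<lambda>q. to_fract (scaleA c 1) * frac_D D x q"])
  show "ring_derivation (\<lambda>q. to_fract (scaleA c 1) * frac_D D x q)"
    by (rule ring_derivation_scaled) unfold_locales
  fix a
  interpret L: Vector_Spaces.linear scaleU scaleA "\<lambda>x. D x a"
    using action by (simp add: lie_action_by_derivations_def)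
  show "frac_D D (scaleU c x) (to_fract a) = to_fract (scaleA c 1) * frac_D D x (to_fract a)"
    by (simp add: frac_D_to_fract L.scale A.scale_one_mult flip: to_fract_mult)
qed unfold_locales

lemma frac_D_bracket:
  "frac_D D (bracket x y) q = frac_D D x (frac_D D y q) - frac_D D y (frac_D D x q)"
proof (rule ring_derivation_fract_eqI[where d = "frac_D D (bracket x y)"
      and e = "\<lambda>q. frac_D D x (frac_D D y q) - frac_D D y (frac_D D x q)"])
  show "ring_derivation (\<lambda>q. frac_D D x (frac_D D y q) - frac_D D y (frac_D D x q))"
    by (rule ring_derivation_commutator) unfold_locales
  fix a
  show "frac_D D (bracket x y) (to_fract a)
      = frac_D D x (frac_D D y (to_fract a)) - frac_D D y (frac_D D x (to_fract a))"
    using action by (simp add: frac_D_to_fract lie_action_by_derivations_def)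
qed unfold_locales

lemma frac_D_zero_left [simp]: "frac_D D 0 q = 0"
  using frac_D_add_left[of 0 0 q] by (simp only: add_0_left add_cancel_right_right)

lemma scale_of_nat_one: "scaleA (of_nat k) 1 = of_nat k"
  by (induction k) (simp_all add: A.scale_left_distrib)

text \<open>The characteristic of the scalars has to be transported to the field of fractions, whose
  type carries no information about it.\<close>

lemma of_nat_fract_nonzero: "k > 0 \<Longrightarrow> (of_nat k :: 'a fract) \<noteq> 0"
proof -
  assume "k > 0"
  then have "(of_nat k :: 'a) \<noteq> 0"
    unfolding scale_of_nat_one[symmetric] by (simp add: A.scale_eq_0_iff)
  then show ?thesis by (simp flip: to_fract_of_nat)
qed

subsection \<open>Localizations\<close>

lemma subalgebra_iff:
  "is_subalgebra (frac_scale scaleA) B \<longleftrightarrow> 0 \<in> B \<and> 1 \<in> B \<and> (\<forall>p\<in>B. \<forall>q\<in>B. p + q \<in> B)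
    \<and> (\<forall>c. \<forall>q\<in>B. frac_scale scaleA c q \<in> B) \<and> (\<forall>p\<in>B. \<forall>q\<in>B. p * q \<in> B)"
  by (auto simp: is_subalgebra_def F.subspace_def)

lemma subalgebra_hull: "is_subalgebra (frac_scale scaleA) (is_subalgebra (frac_scale scaleA) hull S)"
  by (rule hull_in) (auto simp: subalgebra_iff)

lemma localized_subalgebra: "is_subalgebra (frac_scale scaleA) (localized scaleA a0 k)"
proof (cases k)
  case 0
  show ?thesis
    unfolding 0 localized.simps subalgebra_iff
    by (auto simp: frac_scale_def image_iff simp flip: to_fract_add to_fract_mult)
       (metis to_fract_0 to_fract_1)+
qed (simp add: subalgebra_hull)

lemma localized_Suc_subset:
  "insert (inverse (a0 (Suc k))) (localized scaleA a0 k) \<subseteq> localized scaleA a0 (Suc k)"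
  by (simp add: hull_subset del: insert_subset)

text \<open>Inverting constants keeps the algebra stable under the action and the action locally
  nilpotent, because the elements with these two properties form a subalgebra.\<close>

lemma localized_stable_nilpotent:
  assumes "\<And>j x. j < k \<Longrightarrow> frac_D D x (a0 (Suc j)) = 0" and "q \<in> localized scaleA a0 k"
  shows "frac_D D x q \<in> localized scaleA a0 k \<and> (\<exists>l. (frac_D D x ^^ l) q = 0)"
  using assms
proof (induction k arbitrary: q)
  case 0
  then obtain a where q: "q = to_fract a" by auto
  obtain l where "(D x ^^ l) a = 0" by (rule D_nilpotent)
  then show ?case
    by (auto simp: q frac_D_to_fract frac_deriv_iterate_to_fract[OF derivation_D] intro!: exI[of _ l])
next
  case (Suc k)
  let ?L = "localized scaleA a0 (Suc k)"
  let ?G = "{q \<in> ?L. frac_D D x q \<in> ?L \<and> (\<exists>l. (frac_D D x ^^ l) q = 0)}"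
  have L: "is_subalgebra (frac_scale scaleA) ?L" by (rule localized_subalgebra)
  \<comment> \<open>\<open>?L\<close> is a hull, so this inclusion is a structural induction over its elements.\<close>
  have "?L \<subseteq> ?G"
    unfolding localized.simps(2)
  proof (rule hull_minimal, fold localized.simps(2))
    have inv: "frac_D D x (inverse (a0 (Suc k))) = 0"
      by (rule ring_derivation_constant_inverse) (unfold_locales, simp add: Suc.prems(1))
    have "inverse (a0 (Suc k)) \<in> ?G"
      using localized_Suc_subset[of a0 k] L inv
      by (auto simp: subalgebra_iff simp del: localized.simps intro!: exI[of _ 1])
    moreover have "localized scaleA a0 k \<subseteq> ?G"
      using localized_Suc_subset[of a0 k] Suc.IH Suc.prems(1) by (auto simp del: localized.simps)
    ultimately show "insert (inverse (a0 (Suc k))) (localized scaleA a0 k) \<subseteq> ?G" by simp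
    show "is_subalgebra (frac_scale scaleA) ?G"
      unfolding subalgebra_iff
    proof (intro conjI ballI allI)
      show "0 \<in> ?G" using L by (auto simp: subalgebra_iff simp del: localized.simps)
      show "1 \<in> ?G" using L by (auto simp: subalgebra_iff simp del: localized.simps intro!: exI[of _ 1])
    next
      fix p q assume p: "p \<in> ?G" and q: "q \<in> ?G"
      then obtain l r where lr: "(frac_D D x ^^ l) p = 0" "(frac_D D x ^^ r) q = 0" by auto
      then have "(frac_D D x ^^ (l + r)) p = 0" "(frac_D D x ^^ (l + r)) q = 0"
        using DF.iterate_vanishes_mono by simp_all
      then have "(frac_D D x ^^ (l + r)) (p + q) = 0" by (simp add: DF.iterate_add)
      with p q L show "p + q \<in> ?G"
        by (auto simp: subalgebra_iff DF.add simp del: localized.simps)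
      have "(frac_D D x ^^ (l + r)) (p * q) = 0" using DF.iterate_mult_vanishes lr by simp
      with p q L show "p * q \<in> ?G"
        by (auto simp: subalgebra_iff DF.leibniz simp del: localized.simps)
    next
      fix c q assume "q \<in> ?G"
      with L show "frac_scale scaleA c q \<in> ?G"
        by (auto simp: subalgebra_iff frac_D_frac_scale iterate_frac_D_frac_scale
            simp del: localized.simps)
    qed
  qed
  with Suc.prems(2) show ?case by blast
qed

section \<open>The unipotent group\<close>

lemma exp_action_eq_taylor_sum:
  "exp_action scaleA D x = taylor_sum (\<lambda>j. scaleA (1 / fact j) 1) (D x)"
  by (simp add: fun_eq_iff exp_action_def taylor_sum_def A.scale_one_mult)

lemma exp_action_mult:
  "exp_action scaleA D x (a * b) = exp_action scaleA D x a * exp_action scaleA D x b"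
proof -
  have "divided_powers (\<lambda>j. 1 ^ j * scaleA (1 / fact j) 1)"
    by (rule divided_powers_intro) (simp add: A.scale_one_mult flip: scale_of_nat_one)
  moreover obtain k l where "(D x ^^ k) a = 0" "(D x ^^ l) b = 0"
    using D_nilpotent by metis
  ultimately show ?thesis
    unfolding exp_action_eq_taylor_sum by (intro DA.taylor_sum_mult) simp_all
qed

lemma exp_action_nonzero: "a \<noteq> 0 \<Longrightarrow> exp_action scaleA D x a \<noteq> 0"
proof -
  assume "a \<noteq> 0"
  moreover obtain k where "(D x ^^ k) a = 0"
    by (rule D_nilpotent)
  ultimately show ?thesis
    unfolding exp_action_eq_taylor_sum by (intro DA.taylor_sum_nonzero) simp_all
qed

lemma U_invariants_subset: "U_invariants scaleA D \<subseteq> invariants D UNIV UNIV"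
proof
  fix a assume "a \<in> U_invariants scaleA D"
  then have fixed: "taylor_sum (\<lambda>j. scaleA (1 / fact j) 1) (D x) a = a" for x
    by (simp add: U_invariants_def exp_action_eq_taylor_sum)
  have "D x a = 0" for x
  proof -
    obtain k where k: "(D x ^^ k) a = 0" by (rule D_nilpotent)
    show ?thesis by (rule DA.taylor_sum_fixed_imp_constant[OF _ _ _ k fixed]) simp_all
  qed
  then show "a \<in> invariants D UNIV UNIV" by (simp add: invariants_def)
qed

text \<open>If \<open>q = a / b\<close> is a constant, then \<open>a = q b\<close> gives \<open>d ^ j (a) = q d ^ j (b)\<close> for all
  \<open>j\<close>, so the exponential multiplies numerator and denominator alike.\<close>

lemma invariant_fractions_U_invariant:
  assumes "\<And>x. frac_D D x q = 0"
  shows "q \<in> U_invariant_fractions scaleA D"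
  unfolding U_invariant_fractions_def
proof (intro CollectI allI)
  fix x
  obtain a b where q: "q = Fract a b" and b: "b \<noteq> 0" by (cases q)
  then have qb: "q * to_fract b = to_fract a" by (simp add: to_fract_def eq_fract)
  have iter: "q * to_fract ((D x ^^ j) b) = to_fract ((D x ^^ j) a)" for j
    using DF.iterate_constant_mult[OF assms, where k = j, of x "to_fract b"]
    by (simp add: qb frac_deriv_iterate_to_fract[OF derivation_D])
  obtain k l where "(D x ^^ k) a = 0" "(D x ^^ l) b = 0"
    using D_nilpotent by metis
  then have kl: "(D x ^^ (k + l)) a = 0" "(D x ^^ (k + l)) b = 0"
    using DA.iterate_vanishes_mono by simp_all
  have "q * to_fract (exp_action scaleA D x b) = to_fract (exp_action scaleA D x a)"
    by (simp add: exp_action_eq_taylor_sum DA.taylor_sum_eq_sum[OF kl(1)] DA.taylor_sum_eq_sum[OF kl(2)]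
        to_fract_sum sum_distrib_left mult.left_commute[of q] iter)
  then have "Fract (exp_action scaleA D x a) (exp_action scaleA D x b) = q"
    using exp_action_nonzero[OF b] b
    by (simp add: q to_fract_def eq_fract)
  then show "frac_map (exp_action scaleA D x) q = q"
    using frac_map_Fract[of "exp_action scaleA D x", OF exp_action_mult exp_action_nonzero b]
    by (simp add: q)
qed

end

section \<open>The steps of the construction\<close>

locale completed_run =
  lie_action scaleU bracket scaleA D + projector_construction scaleU bracket scaleA D n \<uu> m i xi a0 a1
  for scaleU :: "'k::field_char_0 \<Rightarrow> 'u::ab_group_add \<Rightarrow> 'u"
    and bracket :: "'u \<Rightarrow> 'u \<Rightarrow> 'u"
    and scaleA :: "'k \<Rightarrow> 'a::idom \<Rightarrow> 'a"
    and D :: "'u \<Rightarrow> 'a \<Rightarrow> 'a"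
    and n :: nat and \<uu> :: "nat \<Rightarrow> 'u set"
    and m :: nat and i :: "nat \<Rightarrow> nat" and xi :: "nat \<Rightarrow> 'u"
    and a0 a1 :: "nat \<Rightarrow> 'a fract" +
  assumes finite_dimensional: "\<exists>B. finite_dimensional_vector_space scaleU B"
begin

abbreviation L :: "nat \<Rightarrow> 'a fract set" where
  "L k \<equiv> localized scaleA a0 k"

text \<open>The domain of \<open>S_(k+1)\<close> for \<open>k < m\<close>, and the codomain of \<open>S_k\<close> for \<open>k > 0\<close>.\<close>

definition stage :: "nat \<Rightarrow> 'a fract set" where
  "stage k = invariants (frac_D D) (\<uu> (i k)) (L k)"

text \<open>The whole Lie algebra \<open>\<uu> n\<close> is a candidate for the next index, so the minimum exists and lies
  above \<open>i k\<close>. The predecessor of the minimum either equals \<open>i k\<close> or fails to be a candidate; in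
  both cases its invariants are those of \<open>\<uu> (i k)\<close>. The bound on \<open>i k\<close> is an assumption because
  \<open>index_le\<close> is derived from this lemma by induction.\<close>

lemma next_index_if:
  assumes "k < m" and "i k \<le> n"
  shows "i k < i (Suc k) \<and> i (Suc k) \<le> n \<and>
    invariants (frac_D D) (\<uu> (i (Suc k) - 1)) (L k) = stage k"
proof -
  let ?P = "\<lambda>j. i k < j \<and> j \<le> n \<and> invariants (frac_D D) (\<uu> j) (L k) \<noteq> stage k"
  have "\<uu> n = UNIV" using chain by (simp add: U.ideal_chain_def)
  then have "?P n" using continue[OF assms(1)] assms(2) unfolding stage_def
    by (metis le_neq_implies_less order_refl)
  then have P: "?P (i (Suc k))"
    unfolding least_index[OF assms(1)] stage_def by (rule LeastI)
  have "invariants (frac_D D) (\<uu> (i (Suc k) - 1)) (L k) = stage k"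
  proof (cases "i (Suc k) - 1 = i k")
    case True
    then show ?thesis by (simp add: stage_def)
  next
    case False
    have "i (Suc k) - 1 < (LEAST j. ?P j)"
      using P least_index[OF assms(1)] unfolding stage_def by simp
    then have "\<not> ?P (i (Suc k) - 1)" by (rule not_less_Least)
    then show ?thesis using P False by auto
  qed
  with P show ?thesis by blast
qed

lemma index_le: "k \<le> m \<Longrightarrow> i k \<le> n"
proof (induction k)
  case 0
  show ?case by (simp add: start)
next
  case (Suc k)
  then show ?case using next_index_if[of k] by simp
qed

lemma next_index:
  assumes "k < m"
  shows "0 < i (Suc k)" and "i (Suc k) \<le> n"
    and "invariants (frac_D D) (\<uu> (i (Suc k) - 1)) (L k) = stage k"
  using next_index_if[OF assms index_le] assms by simp_all

text \<open>Adjoining \<open>xi (Suc k)\<close>, which lies outside the predecessor of \<open>\<uu> (i (Suc k))\<close>, raises its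
  dimension by one and so exhausts the codimension.\<close>

lemma ideal_decomposition:
  assumes "k < m" and "y \<in> \<uu> (i (Suc k))"
  obtains c where "y - scaleU c (xi (Suc k)) \<in> \<uu> (i (Suc k) - 1)"
proof -
  obtain B where "finite_dimensional_vector_space scaleU B" using finite_dimensional by blast
  then interpret V: finite_dimensional_vector_space scaleU B .
  obtain j where j: "i (Suc k) = Suc j" and jn: "j < n"
    using next_index[OF assms(1)] by (cases "i (Suc k)") auto
  have sub: "U.subspace (\<uu> j)" "U.subspace (\<uu> (Suc j))"
    and incl: "\<uu> j \<subseteq> \<uu> (Suc j)" and dim: "U.dim (\<uu> (Suc j)) = U.dim (\<uu> j) + 1"
    using chain jn by (auto simp: U.ideal_chain_def U.ideal_def)
  have x: "xi (Suc k) \<in> \<uu> (Suc j)" "xi (Suc k) \<notin> U.span (\<uu> j)"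
    using xi[OF assms(1)] sub(1) by (auto simp: j U.span_eq_iff[THEN iffD2])
  let ?S = "U.span (insert (xi (Suc k)) (\<uu> j))"
  have "?S = \<uu> (Suc j)"
  proof (rule V.subspace_dim_equal)
    show "?S \<subseteq> \<uu> (Suc j)" using incl x(1) sub(2) by (intro U.span_minimal) auto
    show "U.dim (\<uu> (Suc j)) \<le> U.dim ?S" using x(2) by (simp add: V.dim_insert dim)
  qed (auto simp: sub)
  with assms(2) have "y \<in> ?S" by (simp add: j)
  then obtain c where "y - scaleU c (xi (Suc k)) \<in> U.span (\<uu> j)"
    by (auto simp: U.span_insert)
  then show thesis using that sub(1) by (simp add: j U.span_eq_iff[THEN iffD2])
qed

lemma frac_D_a0: "k < m \<Longrightarrow> frac_D D x (a0 (Suc k)) = 0"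
  using a0 by (simp add: invariants_def)

lemma frac_D_stable: "k \<le> m \<Longrightarrow> q \<in> L k \<Longrightarrow> frac_D D x q \<in> L k"
  using localized_stable_nilpotent[of k a0] frac_D_a0 by simp

lemma frac_D_nilpotent:
  assumes "k \<le> m" and "q \<in> L k"
  obtains l where "(frac_D D x ^^ l) q = 0"
  using localized_stable_nilpotent[of k a0] frac_D_a0 assms by fastforce

text \<open>The invariants of an ideal form a subrepresentation: \<open>y x q = x y q - [x, y] q = 0\<close>, since
  both \<open>y\<close> and \<open>[x, y]\<close> lie in the ideal.\<close>

lemma stage_stable:
  assumes "k < m" and "q \<in> stage k"
  shows "(frac_D D x ^^ j) q \<in> stage k"
proof (induction j)
  case 0
  show ?case using assms(2) by simp
next
  case (Suc j)
  let ?q = "(frac_D D x ^^ j) q"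
  have q: "?q \<in> L k" "\<And>y. y \<in> \<uu> (i k) \<Longrightarrow> frac_D D y ?q = 0"
    using Suc by (auto simp: stage_def invariants_def)
  have "frac_D D y (frac_D D x ?q) = 0" if y: "y \<in> \<uu> (i k)" for y
  proof -
    have "bracket x y \<in> \<uu> (i k)"
      using chain y index_le[of k] assms(1) by (auto simp: U.ideal_chain_def U.ideal_def)
    then show ?thesis using q(2) y frac_D_bracket[of x y ?q] by simp
  qed
  then show ?case using q(1) frac_D_stable assms(1) by (simp add: stage_def invariants_def)
qed

definition Q :: "nat \<Rightarrow> 'a fract" where
  "Q k = a1 k * inverse (a0 k)"

definition weight :: "nat \<Rightarrow> nat \<Rightarrow> 'a fract" where
  "weight k j = (- Q k) ^ j * inverse (of_nat (fact j))"

lemma S_map_eq_taylor_sum: "S_map D xi a0 a1 k = taylor_sum (weight k) (frac_D D (xi k))"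
proof
  fix q
  have "(- 1) ^ j * (frac_D D (xi k) ^^ j) q * (Q k ^ j / of_nat (fact j))
      = weight k j * (frac_D D (xi k) ^^ j) q" for j
    by (simp add: weight_def power_minus[of "Q k"] divide_inverse ac_simps)
  then show "S_map D xi a0 a1 k q = taylor_sum (weight k) (frac_D D (xi k)) q"
    by (simp add: S_map_def Let_def taylor_sum_def flip: Q_def)
qed

lemma weight_0 [simp]: "weight k 0 = 1"
  by (simp add: weight_def)

lemma weight_Suc: "of_nat (Suc j) * weight k (Suc j) = - Q k * weight k j"
proof -
  have nz: "(of_nat (Suc j) :: 'a fract) \<noteq> 0" by (rule of_nat_fract_nonzero) simp
  have "(of_nat (fact (Suc j)) :: 'a fract) = of_nat (Suc j) * of_nat (fact j)"
    by (simp only: fact_Suc of_nat_id of_nat_mult)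
  then show ?thesis
    using nz by (simp add: weight_def inverse_mult_distrib del: of_nat_Suc of_nat_fact fact_Suc)
qed

lemma divided_powers_weight: "divided_powers (weight k)"
  unfolding weight_def[abs_def]
  by (rule divided_powers_intro) (simp add: of_nat_fract_nonzero del: of_nat_fact)

lemma weight_constant: "frac_D D y (Q k) = 0 \<Longrightarrow> frac_D D y (weight k j) = 0"
  by (simp add: weight_def DF.leibniz DF.constant_power DF.minus
      ring_derivation_constant_inverse[OF DF.ring_derivation_axioms] del: of_nat_fact)

text \<open>With \<open>w j = (- Q) ^ j / fact j\<close> and \<open>d Q = 1\<close> this is \<open>d (w (j + 1)) = - w j\<close>. The induction
  differentiates \<open>(j + 2) * w (j + 2) = - Q * w (j + 1)\<close>.\<close>

lemma weight_Suc_deriv: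
  assumes Q: "frac_D D x (Q k) = 1"
  shows "frac_D D x (weight k (Suc j)) = - weight k j"
proof (induction j)
  case 0
  then show ?case using Q by (simp add: weight_def DF.minus)
next
  case (Suc j)
  have nz: "(of_nat (Suc (Suc j)) :: 'a fract) \<noteq> 0" by (rule of_nat_fract_nonzero) simp
  have "of_nat (Suc (Suc j)) * frac_D D x (weight k (Suc (Suc j)))
      = frac_D D x (of_nat (Suc (Suc j)) * weight k (Suc (Suc j)))"
    by (simp only: DF.leibniz DF.of_nat mult_zero_left add_0_left)
  also have "\<dots> = - weight k (Suc j) + Q k * weight k j"
    by (simp only: weight_Suc DF.leibniz DF.minus Q Suc.IH) simp
  also have "\<dots> = - weight k (Suc j) - of_nat (Suc j) * weight k (Suc j)"
    by (simp only: weight_Suc) simp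
  also have "\<dots> = of_nat (Suc (Suc j)) * - weight k (Suc j)"
    by (simp add: algebra_simps)
  finally show ?case by (simp only: mult_left_cancel[OF nz])
qed

lemma Q_in_L:
  assumes "k < m"
  shows "Q (Suc k) \<in> L (Suc k)"
proof -
  have "a1 (Suc k) \<in> L k" using a1[OF assms] by (simp add: invariants_def)
  then show ?thesis
    using localized_Suc_subset[of a0 k] localized_subalgebra[of a0 "Suc k"]
    by (auto simp: Q_def subalgebra_iff simp del: localized.simps)
qed

lemma frac_D_Q:
  assumes "k < m"
  shows "frac_D D x (Q (Suc k)) = frac_D D x (a1 (Suc k)) * inverse (a0 (Suc k))"
proof -
  have "frac_D D x (inverse (a0 (Suc k))) = 0"
    by (rule ring_derivation_constant_inverse[OF DF.ring_derivation_axioms frac_D_a0[OF assms]])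
  then show ?thesis by (simp add: Q_def DF.leibniz)
qed

lemma weight_in_L:
  assumes "k < m"
  shows "weight (Suc k) j \<in> L (Suc k)"
proof -
  have A: "is_subalgebra (frac_scale scaleA) (L (Suc k))" by (rule localized_subalgebra)
  have c: "frac_scale scaleA c q \<in> L (Suc k)" if "q \<in> L (Suc k)" for c q
    using A that by (simp add: subalgebra_iff)
  have "- Q (Suc k) \<in> L (Suc k)" using c[OF Q_in_L[OF assms], of "- 1"] by simp
  then have p: "(- Q (Suc k)) ^ j \<in> L (Suc k)"
    using A by (induction j) (simp_all add: subalgebra_iff del: localized.simps mult_minus_left)
  have "inverse (of_nat (fact j)) = to_fract (scaleA (1 / fact j) 1)"
  proof (rule inverse_unique)
    show "of_nat (fact j) * to_fract (scaleA (1 / fact j) 1) = 1"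
      by (simp add: A.scale_one_mult flip: to_fract_of_nat scale_of_nat_one to_fract_mult)
  qed
  then have "weight (Suc k) j = frac_scale scaleA (1 / fact j) ((- Q (Suc k)) ^ j)"
    by (simp add: weight_def frac_scale_def mult.commute)
  then show ?thesis using c[OF p] by simp
qed

text \<open>The value is killed by \<open>xi (Suc k)\<close> since the sum telescopes, and by the preceding ideal of
  the chain since both the iterates of \<open>q\<close> and \<open>Q (Suc k)\<close> are. Only the powers of
  \<open>Q (Suc k)\<close> need the new denominator.\<close>

lemma S_map_in_stage:
  assumes k: "k < m" and q: "q \<in> stage k"
  shows "S_map D xi a0 a1 (Suc k) q \<in> stage (Suc k)"
proof -
  let ?x = "xi (Suc k)" and ?w = "weight (Suc k)"
  let ?S = "taylor_sum ?w (frac_D D ?x) q"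
  have "q \<in> L k" using q by (simp add: stage_def invariants_def)
  then obtain l where l: "(frac_D D ?x ^^ l) q = 0" using frac_D_nilpotent k by (meson less_imp_le)
  have S: "?S = (\<Sum>j<l. ?w j * (frac_D D ?x ^^ j) q)" by (rule DF.taylor_sum_eq_sum[OF l])
  have A: "is_subalgebra (frac_scale scaleA) (L (Suc k))" by (rule localized_subalgebra)
  have it: "(frac_D D ?x ^^ j) q \<in> stage k" for j by (rule stage_stable[OF k q])
  then have "(frac_D D ?x ^^ j) q \<in> L (Suc k)" for j
    using localized_Suc_subset[of a0 k] by (auto simp: stage_def invariants_def simp del: localized.simps)
  then have "?w j * (frac_D D ?x ^^ j) q \<in> L (Suc k)" for j
    using A weight_in_L[OF k] by (simp add: subalgebra_iff del: localized.simps)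
  then have SL: "?S \<in> L (Suc k)"
    unfolding S using A by (induction l) (simp_all add: subalgebra_iff del: localized.simps)
  have "frac_D D ?x (Q (Suc k)) = 1"
    using D_a1[OF k] a0_nonzero[OF k] by (simp add: frac_D_Q[OF k])
  then have Sx: "frac_D D ?x ?S = 0"
    by (intro DF.taylor_sum_in_kernel[where w = ?w, OF _ _ l]) (simp_all add: weight_Suc_deriv)
  have old: "frac_D D z p = 0" if "p \<in> stage k" "z \<in> \<uu> (i (Suc k) - 1)" for p z
    using that next_index(3)[OF k] by (auto simp: invariants_def)
  have Sz: "frac_D D z ?S = 0" if z: "z \<in> \<uu> (i (Suc k) - 1)" for z
  proof -
    have "a1 (Suc k) \<in> stage k" using a1[OF k] by (simp add: stage_def)
    then have "frac_D D z (Q (Suc k)) = 0" using old z by (simp add: frac_D_Q[OF k])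
    then show ?thesis
      unfolding S by (simp add: DF.sum DF.leibniz weight_constant old[OF it z])
  qed
  have "frac_D D y ?S = 0" if y: "y \<in> \<uu> (i (Suc k))" for y
  proof -
    obtain c where c: "y - scaleU c ?x \<in> \<uu> (i (Suc k) - 1)" using ideal_decomposition[OF k y] .
    have "frac_D D ((y - scaleU c ?x) + scaleU c ?x) ?S = 0"
      unfolding frac_D_add_left frac_D_scale_left Sx Sz[OF c] by simp
    then show ?thesis by simp
  qed
  with SL show ?thesis by (simp add: S_map_eq_taylor_sum stage_def invariants_def)
qed

subsection \<open>The composition\<close>

lemma S_map_mult:
  assumes "k \<le> m" and "p \<in> L k" and "q \<in> L k"
  shows "S_map D xi a0 a1 j (p * q) = S_map D xi a0 a1 j p * S_map D xi a0 a1 j q"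
  unfolding S_map_eq_taylor_sum
  using frac_D_nilpotent[OF assms(1,2)] frac_D_nilpotent[OF assms(1,3)]
  by (meson DF.taylor_sum_mult divided_powers_weight)

lemma S_map_add:
  assumes "k \<le> m" and "p \<in> L k" and "q \<in> L k"
  shows "S_map D xi a0 a1 j (p + q) = S_map D xi a0 a1 j p + S_map D xi a0 a1 j q"
  unfolding S_map_eq_taylor_sum
  using frac_D_nilpotent[OF assms(1,2)] frac_D_nilpotent[OF assms(1,3)]
  by (meson DF.taylor_sum_add)

lemma S_map_constant: "frac_D D (xi j) q = 0 \<Longrightarrow> S_map D xi a0 a1 j q = q"
  by (simp add: S_map_eq_taylor_sum DF.taylor_sum_constant)

lemma S_composition_constant:
  assumes "\<And>x. frac_D D x q = 0"
  shows "S_composition D xi a0 a1 k q = q"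
  by (induction k) (simp_all add: S_map_constant assms)

text \<open>The initial stage is the full algebra, as \<open>\<uu> 0\<close> is zero.\<close>

lemma S_composition_in_stage:
  assumes "k \<le> m"
  shows "S_composition D xi a0 a1 k (to_fract a) \<in> stage k"
  using assms
proof (induction k)
  case 0
  have "\<uu> 0 = {0}" using chain by (simp add: U.ideal_chain_def)
  then show ?case by (simp add: stage_def invariants_def start)
next
  case (Suc k)
  then show ?case by (simp add: S_map_in_stage)
qed

lemma S_composition_in_L: "k \<le> m \<Longrightarrow> S_composition D xi a0 a1 k (to_fract a) \<in> L k"
  using S_composition_in_stage by (simp add: stage_def invariants_def)

lemma S_composition_hom:
  assumes "k \<le> m"
  shows "S_composition D xi a0 a1 k (to_fract (a + b))
      = S_composition D xi a0 a1 k (to_fract a) + S_composition D xi a0 a1 k (to_fract b) \<and>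
    S_composition D xi a0 a1 k (to_fract (a * b))
      = S_composition D xi a0 a1 k (to_fract a) * S_composition D xi a0 a1 k (to_fract b)"
  using assms
proof (induction k)
  case 0
  show ?case by simp
next
  case (Suc k)
  then show ?case
    using S_map_add[of k] S_map_mult[of k] S_composition_in_L[of k] by simp
qed

lemma P_map_constant:
  assumes "\<And>x. D x a = 0"
  shows "P_map D xi a0 a1 m a = to_fract a"
  unfolding P_map_def by (rule S_composition_constant) (simp add: frac_D_to_fract assms)

lemma P_map_algebra_hom: "algebra_hom scaleA (frac_scale scaleA) (P_map D xi a0 a1 m)"
proof -
  let ?P = "P_map D xi a0 a1 m"
  have add: "?P (a + b) = ?P a + ?P b" and mult: "?P (a * b) = ?P a * ?P b" for a b
    using S_composition_hom[of m a b] by (simp_all add: P_map_def)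
  \<comment> \<open>Scalars are constants, so linearity follows from multiplicativity.\<close>
  have "?P (scaleA c a) = frac_scale scaleA c (?P a)" for c a
    using mult[of "scaleA c 1" a] P_map_constant[of "scaleA c 1"]
    by (simp add: A.scale_one_mult frac_scale_def)
  moreover have "?P 1 = 1" using P_map_constant[of 1] by simp
  ultimately show ?thesis
    unfolding algebra_hom_def using add mult
    by (auto intro!: Vector_Spaces.linear.intro module_hom.intro module_hom_axioms.intro
        A.module_axioms F.module_axioms A.vector_space_axioms F.vector_space_axioms)
qed

lemma P_map_invariant: "P_map D xi a0 a1 m a \<in> invariants (frac_D D) UNIV (L m)"
  using S_composition_in_stage[of m a] stop by (simp add: stage_def P_map_def)

end

theorem theorem2p2:
  fixes scaleU :: "'k::field_char_0 \<Rightarrow> 'u::ab_group_add \<Rightarrow> 'u"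
    and bracket :: "'u \<Rightarrow> 'u \<Rightarrow> 'u"
    and scaleA :: "'k \<Rightarrow> 'a::idom \<Rightarrow> 'a"
    and D :: "'u \<Rightarrow> 'a \<Rightarrow> 'a"
    and n m :: nat and \<uu> :: "nat \<Rightarrow> 'u set"
    and i :: "nat \<Rightarrow> nat" and xi :: "nat \<Rightarrow> 'u"
    and a0 a1 :: "nat \<Rightarrow> 'a fract"
    and P :: "'a \<Rightarrow> 'a fract"
  assumes "lie_algebra scaleU bracket"
    and "\<exists>B. finite_dimensional_vector_space scaleU B"
    and "lie_algebra.nilpotent scaleU bracket"
    and "comm_algebra scaleA"
    and "finitely_generated_algebra scaleA"
    and "lie_action_by_derivations scaleU bracket scaleA D"
    and "\<And>x. locally_nilpotent (D x)"
    and "projector_construction scaleU bracket scaleA D n \<uu> m i xi a0 a1"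
    and "P = P_map D xi a0 a1 m"
  shows "algebra_hom scaleA (frac_scale scaleA) P
    \<and> range P \<subseteq> invariants (frac_D D) UNIV (localized scaleA a0 m)
    \<and> (\<forall>a \<in> invariants D UNIV UNIV. P a = to_fract a)
    \<and> U_projector scaleA D P"
proof -
  interpret completed_run scaleU bracket scaleA D n \<uu> m i xi a0 a1
    using assms by (intro completed_run.intro lie_action.intro lie_action_axioms.intro
        completed_run_axioms.intro)
  have inv: "P a \<in> invariants (frac_D D) UNIV (localized scaleA a0 m)" for a
    using P_map_invariant by (simp add: assms(9))
  then have "range P \<subseteq> U_invariant_fractions scaleA D"
    by (auto simp: invariants_def intro!: invariant_fractions_U_invariant)
  moreover have "P a = to_fract a" if "a \<in> invariants D UNIV UNIV" for a
    using P_map_constant that by (simp add: assms(9) invariants_def)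
  ultimately show ?thesis
    using inv P_map_algebra_hom U_invariants_subset by (auto simp: U_projector_def assms(9))
qed

end
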